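(* Consider the optimal control problem $$\min \int_0^T\big(y^TYy+y^TNu+\ell^Tu\big)\,dt\quad\text{s.t.}\quad \dot x=(J-R)Qx+Gu,\quad x(0)=x^0,\quad y=G^TQx,$$ with controls $u\in L^\infty([0,T];\mathbb{R}^m)$ satisfying $u(t)\in\mathbb{U}$ for a.e. $t$, where $\mathbb{U}\subseteq\mathbb{R}^m$ is open. Along optimal trajectories (i.e., whenever the problem admits an optimal trajectory), the matrix $$N^TG^TQG$$ is symmetric.
   Context: Data: $J\in\mathbb{R}^{n,n}$ is skew-symmetric; $R\in\mathbb{R}^{n,n}$ is symmetric positive semidefinite; $Q\in\mathbb{R}^{n,n}$ is symmetric positive definite; $G\in\mathbb{R}^{n,m}$ has full rank $m\le n$; $Y\in\mathbb{R}^{m,m}$ is symmetric positive semidefinite; $N\in\mathbb{R}^{m,m}$; $\ell\in\mathbb{R}^m$. States belong to $W^{1,\infty}([0,T];\mathbb{R}^n)$. *)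

theory Defs
  imports "HOL-Analysis.Analysis"
begin

definition pos_semidef :: "real ^ 'k ^ 'k \<Rightarrow> bool" where
  "pos_semidef A \<longleftrightarrow> transpose A = A \<and> (\<forall>v. v \<bullet> (A *v v) \<ge> 0)"

definition pos_def :: "real ^ 'k ^ 'k \<Rightarrow> bool" where
  "pos_def A \<longleftrightarrow> transpose A = A \<and> (\<forall>v. v \<noteq> 0 \<longrightarrow> v \<bullet> (A *v v) > 0)"

text \<open>Membership in \<open>L\<^sup>\<infinity>([0,T])\<close>; functions are not identified up to null sets, and their
  values outside \<open>[0,T]\<close> are irrelevant.\<close>

definition L_infty :: "real \<Rightarrow> (real \<Rightarrow> 'a::euclidean_space) \<Rightarrow> bool" where
  "L_infty T f \<longleftrightarrow> f \<in> borel_measurable (lebesgue_on {0..T}) \<and>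
     (\<exists>C. AE t in lebesgue_on {0..T}. norm (f t) \<le> C)"

definition test_function :: "real \<Rightarrow> (real \<Rightarrow> real) \<Rightarrow> bool" where
  "test_function T \<phi> \<longleftrightarrow> \<phi> C1_differentiable_on UNIV \<and> closure {t. \<phi> t \<noteq> 0} \<subseteq> {0<..<T}"

definition has_weak_derivative ::
  "real \<Rightarrow> (real \<Rightarrow> 'a::euclidean_space) \<Rightarrow> (real \<Rightarrow> 'a) \<Rightarrow> bool" where
  "has_weak_derivative T x g \<longleftrightarrow> (\<forall>\<phi>. test_function T \<phi> \<longrightarrow>
     (LINT t|lebesgue_on {0..T}. deriv \<phi> t *\<^sub>R x t) =
       - (LINT t|lebesgue_on {0..T}. \<phi> t *\<^sub>R g t))"

text \<open>Membership in \<open>W\<^sup>1\<^sup>,\<^sup>\<infinity>([0,T])\<close>. Every Sobolev class has exactly one continuous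
  representative on \<open>[0,T]\<close>; continuity selects it, which gives meaning to the
  initial value.\<close>

definition W1_infty :: "real \<Rightarrow> (real \<Rightarrow> 'a::euclidean_space) \<Rightarrow> bool" where
  "W1_infty T x \<longleftrightarrow> continuous_on {0..T} x \<and> L_infty T x \<and>
     (\<exists>g. L_infty T g \<and> has_weak_derivative T x g)"

definition port_output :: "real ^ 'm ^ 'n \<Rightarrow> real ^ 'n ^ 'n \<Rightarrow> real ^ 'n \<Rightarrow> real ^ 'm" where
  "port_output G Q x = transpose G *v (Q *v x)"

text \<open>Weak derivatives are unique up to null sets, so the last conjunct is the differential
  equation holding almost everywhere.\<close>

definition admissible ::
  "real \<Rightarrow> real ^ 'n ^ 'n \<Rightarrow> real ^ 'n ^ 'n \<Rightarrow> real ^ 'n ^ 'n \<Rightarrow> real ^ 'm ^ 'n \<Rightarrow> real ^ 'n \<Rightarrow>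
   (real ^ 'm) set \<Rightarrow> (real \<Rightarrow> real ^ 'n) \<Rightarrow> (real \<Rightarrow> real ^ 'm) \<Rightarrow> bool" where
  "admissible T J R Q G x0 U x u \<longleftrightarrow>
     L_infty T u \<and> (AE t in lebesgue_on {0..T}. u t \<in> U) \<and>
     W1_infty T x \<and> x 0 = x0 \<and>
     has_weak_derivative T x (\<lambda>t. ((J - R) ** Q) *v x t + G *v u t)"

definition cost ::
  "real \<Rightarrow> real ^ 'n ^ 'n \<Rightarrow> real ^ 'm ^ 'n \<Rightarrow> real ^ 'm ^ 'm \<Rightarrow> real ^ 'm ^ 'm \<Rightarrow> real ^ 'm \<Rightarrow>
   (real \<Rightarrow> real ^ 'n) \<Rightarrow> (real \<Rightarrow> real ^ 'm) \<Rightarrow> real" where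
  "cost T Q G Y N l x u = (LINT t|lebesgue_on {0..T}.
     (let y = port_output G Q (x t) in y \<bullet> (Y *v y) + y \<bullet> (N *v u t) + l \<bullet> u t))"

definition optimal ::
  "real \<Rightarrow> real ^ 'n ^ 'n \<Rightarrow> real ^ 'n ^ 'n \<Rightarrow> real ^ 'n ^ 'n \<Rightarrow> real ^ 'm ^ 'n \<Rightarrow>
   real ^ 'm ^ 'm \<Rightarrow> real ^ 'm ^ 'm \<Rightarrow> real ^ 'm \<Rightarrow> real ^ 'n \<Rightarrow> (real ^ 'm) set \<Rightarrow>
   (real \<Rightarrow> real ^ 'n) \<Rightarrow> (real \<Rightarrow> real ^ 'm) \<Rightarrow> bool" where
  "optimal T J R Q G Y N l x0 U x u \<longleftrightarrow> admissible T J R Q G x0 U x u \<and>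
     (\<forall>x' u'. admissible T J R Q G x0 U x' u' \<longrightarrow> cost T Q G Y N l x u \<le> cost T Q G Y N l x' u')"

end

theory Submission
  imports Defs
begin

text \<open>The Hamiltonian is affine in the control, so the problem is singular, and the symmetry is a
condition of second order, found by testing the optimal pair with fast small loops of the control.

The dynamics are linear and the cost integrand is a quadratic polynomial of state and control
without a term quadratic in the control. Let \<open>C = G\<^sup>T Q\<close>. If \<open>z\<close> solves
\<open>z' = (J - R) Q z + G v\<close>, \<open>z 0 = 0\<close>, and both \<open>u + s v\<close> and \<open>u - s v\<close> take values in \<open>U\<close> for some
\<open>s > 0\<close>, then optimality forces
\<open>B(v) = \<integral> (C z) \<bullet> (Y C z) + (C z) \<bullet> (N v) \<ge> 0\<close> (\<open>second_variation_nonneg\<close>).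

Let the primitive \<open>w\<close> of \<open>v\<close> describe a closed curve in the plane spanned by two vectors \<open>a\<close> and
\<open>b\<close>, enclosing oriented area \<open>1\<close> and traversed within time \<open>h\<close>. For small \<open>h\<close> the
drift has no time to act, so \<open>z\<close> is \<open>G w\<close> up to an error of order \<open>h\<close>, and \<open>B(v)\<close> is
\<open>\<integral> (C G w) \<bullet> (N w') = (C G a) \<bullet> (N b) - (C G b) \<bullet> (N a)\<close> up to an error of order \<open>h\<close>
(\<open>loop_response_cost\<close>). Letting \<open>h\<close> tend to \<open>0\<close> and exchanging \<open>a\<close> and \<open>b\<close> shows that
the bilinear form \<open>(C G p) \<bullet> (N q)\<close> is symmetric, which is the symmetry of
\<open>N\<^sup>T G\<^sup>T Q G\<close>.

The control \<open>u\<close> is only measurable and \<open>U\<close> only open, so \<open>v\<close> must be supported on a measurable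
set on which \<open>u\<close> keeps a fixed distance from the complement of \<open>U\<close>
(\<open>uniformly_interior_set_exists\<close>). Built from indicators of pieces of this set, each divided by
its measure, the loop has area \<open>1\<close> no matter how thin the set is (\<open>loop_controls_exist\<close>). The
states are Lipschitz rather than differentiable, and the differential equation is treated as an
integral equation (\<open>linear_volterra_solution\<close>), its weak form being integration by parts for
primitives (\<open>has_weak_derivative_primitive\<close>).\<close>

section \<open>Essentially bounded functions on an interval\<close>

lemma finite_measure_interval: "finite_measure (lebesgue_on {a..b::real})"
  by (rule finite_measure_lebesgue_on) simp

lemma L_infty_measurable: "L_infty T f \<Longrightarrow> f \<in> borel_measurable (lebesgue_on {0..T})"
  by (simp add: L_infty_def)

lemma L_infty_integrable: "L_infty T f \<Longrightarrow> integrable (lebesgue_on {0..T}) f"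
  unfolding L_infty_def
  using finite_measure.integrable_const_bound[OF finite_measure_interval] by blast

lemma L_infty_bounded:
  assumes "f \<in> borel_measurable (lebesgue_on {0..T})" "\<And>t. t \<in> {0..T} \<Longrightarrow> norm (f t) \<le> C"
  shows "L_infty T f"
  unfolding L_infty_def using assms by (auto intro!: exI[of _ C] AE_I2)

lemma L_infty_continuous:
  assumes "continuous_on {0..T} f"
  shows "L_infty T f"
proof -
  have "bounded (f ` {0..T})"
    using assms compact_continuous_image compact_imp_bounded by blast
  then obtain C where "\<And>t. t \<in> {0..T} \<Longrightarrow> norm (f t) \<le> C"
    unfolding bounded_iff by blast
  then show ?thesis
    using continuous_imp_measurable_on_sets_lebesgue[OF assms] L_infty_bounded[of f T C] by simp
qed

lemma L_infty_add:
  assumes "L_infty T f" "L_infty T g"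
  shows "L_infty T (\<lambda>t. f t + g t)"
proof -
  from assms obtain C D where *: "AE t in lebesgue_on {0..T}. norm (f t) \<le> C"
    "AE t in lebesgue_on {0..T}. norm (g t) \<le> D" by (auto simp: L_infty_def)
  have "AE t in lebesgue_on {0..T}. norm (f t + g t) \<le> C + D"
    using * by eventually_elim (rule norm_triangle_mono)
  then show ?thesis using assms by (auto simp: L_infty_def)
qed

lemma L_infty_bounded_bilinear:
  assumes "bounded_bilinear B" "L_infty T f" "L_infty T g"
  shows "L_infty T (\<lambda>t. B (f t) (g t))"
proof -
  interpret bounded_bilinear B by fact
  obtain K where K: "K > 0" "\<And>a b. norm (B a b) \<le> norm a * norm b * K"
    using pos_bounded by blast
  from assms obtain C D where *: "AE t in lebesgue_on {0..T}. norm (f t) \<le> C"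
    "AE t in lebesgue_on {0..T}. norm (g t) \<le> D" by (auto simp: L_infty_def)
  have "AE t in lebesgue_on {0..T}. norm (B (f t) (g t)) \<le> C * D * K"
    using *
  proof eventually_elim
    case (elim t)
    have "norm (f t) * norm (g t) * K \<le> C * D * K"
      using elim K by (intro mult_right_mono mult_mono) (auto intro: order_trans[OF norm_ge_zero])
    then show ?case using K(2)[of "f t" "g t"] by linarith
  qed
  moreover have "(\<lambda>t. B (f t) (g t)) \<in> borel_measurable (lebesgue_on {0..T})"
    by (rule borel_measurable_continuous_Pair[OF L_infty_measurable[OF assms(2)] L_infty_measurable[OF assms(3)]])
      (rule continuous_on[OF continuous_on_fst[OF continuous_on_id] continuous_on_snd[OF continuous_on_id]])
  ultimately show ?thesis by (auto simp: L_infty_def)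
qed

lemma L_infty_const: "L_infty T (\<lambda>t. c)"
  by (rule L_infty_continuous) simp

lemma L_infty_scaleR: "L_infty T f \<Longrightarrow> L_infty T g \<Longrightarrow> L_infty T (\<lambda>t. f t *\<^sub>R g t)"
  by (rule L_infty_bounded_bilinear[OF bounded_bilinear_scaleR])

lemma L_infty_inner: "L_infty T f \<Longrightarrow> L_infty T g \<Longrightarrow> L_infty T (\<lambda>t. f t \<bullet> g t)"
  by (rule L_infty_bounded_bilinear[OF bounded_bilinear_inner])

lemma L_infty_matrix_vector_mult:
  fixes A :: "real ^ 'a ^ 'b"
  assumes "L_infty T f"
  shows "L_infty T (\<lambda>t. A *v f t)"
proof -
  \<comment> \<open>A linear map is the bilinear map \<open>c *\<^sub>R (A *v v)\<close> at \<open>c = 1\<close>.\<close>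
  have "bounded_bilinear (\<lambda>c v. c *\<^sub>R (A *v v))"
    by (rule bounded_bilinear.comp[OF bounded_bilinear_scaleR bounded_linear_ident matrix_vector_mul_bounded_linear])
  from L_infty_bounded_bilinear[OF this L_infty_const[of T 1] assms] show ?thesis by simp
qed

section \<open>Primitives of integrable functions and their weak derivatives\<close>

text \<open>The integral of \<open>q\<close> over \<open>[0,t)\<close>, written as one integral over all of \<open>[0,T]\<close>, so that
integrals of primitives become iterated integrals over a fixed square. The half-open interval fits
the half-open supports of the pulses below: up to the instant at which a pulse starts, the integrand
vanishes identically.\<close>

definition primitive :: "real \<Rightarrow> (real \<Rightarrow> 'a::euclidean_space) \<Rightarrow> real \<Rightarrow> 'a" where
  "primitive T q t = (LINT s|lebesgue_on {0..T}. indicator {..<t} s *\<^sub>R q s)"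

lemma primitive_eq_integral:
  assumes q: "integrable (lebesgue_on {0..T}) q" and t: "t \<in> {0..T}"
  shows "primitive T q t = integral {0..t} q"
proof -
  have "primitive T q t = (LINT s|lebesgue_on {0..T}. (if s \<in> {0..<t} then q s else 0))"
    unfolding primitive_def by (rule Bochner_Integration.integral_cong) (auto simp: indicator_def)
  also have "\<dots> = (LINT s|lebesgue_on {0..<t}. q s)"
    using t by (intro Lebesgue_Measure.integral_restrict) auto
  also have "\<dots> = integral {0..<t} q"
  proof (rule lebesgue_integral_eq_integral)
    have "set_integrable lebesgue {0..T} q"
      using q by (simp add: integrable_restrict_space set_integrable_def)
    then have "set_integrable lebesgue {0..<t} q"
      by (rule set_integrable_subset) (use t in auto)
    then show "integrable (lebesgue_on {0..<t}) q"
      by (simp add: integrable_restrict_space set_integrable_def)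
  qed simp
  also have "\<dots> = integral {0..t} q"
    by (rule integral_spike_set; rule negligible_subset[of "{t}"]; auto)
  finally show ?thesis .
qed

lemma continuous_on_primitive:
  assumes "integrable (lebesgue_on {0..T}) q"
  shows "continuous_on {0..T} (primitive T q)"
proof -
  have "q integrable_on {0..T}"
    using assms by (rule integrable_on_lebesgue_on) simp
  then have "continuous_on {0..T} (\<lambda>t. integral {0..t} q)"
    by (rule indefinite_integral_continuous_1)
  then show ?thesis
    by (rule continuous_on_eq) (simp add: primitive_eq_integral[OF assms])
qed

lemma integrable_indicator_lebesgue_on:
  fixes q :: "real \<Rightarrow> 'a::euclidean_space"
  assumes "integrable (lebesgue_on {0..T}) q" "B \<in> sets lebesgue"
  shows "integrable (lebesgue_on {0..T}) (\<lambda>s. indicator B s *\<^sub>R q s)"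
proof (rule Bochner_Integration.integrable_bound[OF assms(1)])
  have "(indicator B :: real \<Rightarrow> real) \<in> borel_measurable (lebesgue_on {0..T})"
    by (intro measurable_restrict_space1 borel_measurable_indicator assms)
  then show "(\<lambda>s. indicator B s *\<^sub>R q s) \<in> borel_measurable (lebesgue_on {0..T})"
    using assms by (intro borel_measurable_scaleR) auto
qed (auto simp: indicator_def)

lemma integrable_indicator_lessThan:
  fixes q :: "real \<Rightarrow> 'a::euclidean_space"
  assumes "integrable (lebesgue_on {0..T}) q"
  shows "integrable (lebesgue_on {0..T}) (\<lambda>s. indicator {..<t} s *\<^sub>R q s)"
  by (rule integrable_indicator_lebesgue_on[OF assms]) simp

lemma primitive_add:
  assumes "integrable (lebesgue_on {0..T}) p" "integrable (lebesgue_on {0..T}) q"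
  shows "primitive T (\<lambda>t. p t + q t) t = primitive T p t + primitive T q t"
  using assms by (simp add: primitive_def scaleR_add_right integrable_indicator_lessThan)

lemma primitive_diff:
  assumes "integrable (lebesgue_on {0..T}) p" "integrable (lebesgue_on {0..T}) q"
  shows "primitive T (\<lambda>t. p t - q t) t = primitive T p t - primitive T q t"
  using assms by (simp add: primitive_def scaleR_diff_right integrable_indicator_lessThan del: real_scaleR_def)

lemma primitive_bounded_linear:
  assumes "bounded_linear L" "integrable (lebesgue_on {0..T}) q"
  shows "primitive T (\<lambda>t. L (q t)) t = L (primitive T q t)"
proof -
  interpret bounded_linear L by fact
  show ?thesis
    using integral_bounded_linear[OF assms(1) integrable_indicator_lessThan[OF assms(2)]]
    by (simp add: primitive_def scaleR)
qed

lemma AE_lebesgue_on_neq: "AE s in lebesgue_on {a..b::real}. s \<noteq> c"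
proof -
  have "AE s in lebesgue. s \<noteq> c"
    using AE_not_in[of "{c}" lebesgue] by simp
  then show ?thesis
    by (subst AE_restrict_space_iff) auto
qed

lemma primitive_at_end:
  assumes "integrable (lebesgue_on {0..T}) q"
  shows "primitive T q T = (LINT s|lebesgue_on {0..T}. q s)"
  unfolding primitive_def
proof (rule integral_cong_AE)
  show "AE s in lebesgue_on {0..T}. indicator {..<T} s *\<^sub>R q s = q s"
    using AE_lebesgue_on_neq[of T 0 T] AE_space[of "lebesgue_on {0..T}"] by eventually_elim auto
qed (intro borel_measurable_integrable integrable_indicator_lessThan assms)+

text \<open>By Fubini: \<open>p t *\<^sub>R q s\<close> integrated over the square \<open>[0,T]\<^sup>2\<close> is the product of the two integrals;
the triangle \<open>s < t\<close> contributes \<open>p\<close> times the primitive of \<open>q\<close>, the triangle \<open>t < s\<close>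
contributes the primitive of \<open>p\<close> times \<open>q\<close>, and every slice of the diagonal is a null set.\<close>
lemma integration_by_parts_primitive:
  fixes p :: "real \<Rightarrow> real" and q :: "real \<Rightarrow> 'a::euclidean_space"
  assumes p: "integrable (lebesgue_on {0..T}) p" and q: "integrable (lebesgue_on {0..T}) q"
  shows "(LINT t|lebesgue_on {0..T}. p t *\<^sub>R primitive T q t) =
    (LINT t|lebesgue_on {0..T}. p t) *\<^sub>R (LINT t|lebesgue_on {0..T}. q t) -
    (LINT t|lebesgue_on {0..T}. primitive T p t *\<^sub>R q t)"
proof -
  let ?M = "lebesgue_on {0..T}"
  interpret finite_measure ?M by (rule finite_measure_interval)
  interpret P: pair_sigma_finite ?M ?M ..
  have id: "(\<lambda>t. t) \<in> borel_measurable ?M"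
    by (intro measurable_restrict_space1) (simp add: measurable_completion)
  have prod_meas: "(\<lambda>w. p (fst w) *\<^sub>R q (snd w)) \<in> borel_measurable (?M \<Otimes>\<^sub>M ?M)"
    using p q by (intro borel_measurable_scaleR measurable_compose[OF measurable_fst]
      measurable_compose[OF measurable_snd]) auto
  have prod: "integrable (?M \<Otimes>\<^sub>M ?M) (\<lambda>w. p (fst w) *\<^sub>R q (snd w))"
    by (rule P.Fubini_integrable[OF prod_meas]) (use p q in auto)
  have "{w \<in> space (?M \<Otimes>\<^sub>M ?M). fst w < snd w} \<in> sets (?M \<Otimes>\<^sub>M ?M)"
    by (intro borel_measurable_less measurable_compose[OF measurable_fst id]
      measurable_compose[OF measurable_snd id])
  then have "(indicator {w. fst w < snd w} :: real \<times> real \<Rightarrow> real) \<in> borel_measurable (?M \<Otimes>\<^sub>M ?M)"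
    by (simp add: borel_measurable_indicator_iff Int_def conj_commute)
  then have "integrable (?M \<Otimes>\<^sub>M ?M)
      (\<lambda>w. indicator {w. fst w < snd w} w *\<^sub>R (p (fst w) *\<^sub>R q (snd w)))"
    by (rule Bochner_Integration.integrable_bound[OF prod borel_measurable_scaleR[OF _ prod_meas]])
      (auto simp: indicator_def)
  then have upper: "integrable (?M \<Otimes>\<^sub>M ?M)
      (\<lambda>(t, s). indicator {w. fst w < snd w} (t, s) *\<^sub>R (p t *\<^sub>R q s))"
    by (simp only: split_beta' prod.collapse)
  have lower_eq: "p t *\<^sub>R primitive T q t =
      (LINT s|?M. indicator {..<t} s *\<^sub>R (p t *\<^sub>R q s))" for t
    using integral_scaleR_right[of ?M "p t" "\<lambda>s. indicator {..<t} s *\<^sub>R q s"]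
      integrable_indicator_lessThan[OF q]
    by (simp add: primitive_def mult.commute)
  have upper_eq: "primitive T p s *\<^sub>R q s =
      (LINT t|?M. indicator {w. fst w < snd w} (t, s) *\<^sub>R (p t *\<^sub>R q s))" for s
    using integral_scaleR_left[where c="q s" and M="?M" and f="\<lambda>t. indicator {..<s} t *\<^sub>R p t"]
      integrable_indicator_lessThan[OF p]
    by (simp add: primitive_def indicator_def)
  have split: "p t *\<^sub>R primitive T q t +
      (LINT s|?M. indicator {w. fst w < snd w} (t, s) *\<^sub>R (p t *\<^sub>R q s)) =
      p t *\<^sub>R (LINT s|?M. q s)" for t
  proof -
    have i2: "integrable ?M (\<lambda>s. indicator {w. fst w < snd w} (t, s) *\<^sub>R (p t *\<^sub>R q s))"
      using integrable_indicator_lebesgue_on[of T "\<lambda>s. p t *\<^sub>R q s" "{t<..}"] q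
      by (simp add: indicator_def)
    have "p t *\<^sub>R primitive T q t +
        (LINT s|?M. indicator {w. fst w < snd w} (t, s) *\<^sub>R (p t *\<^sub>R q s)) =
        (LINT s|?M. indicator {..<t} s *\<^sub>R (p t *\<^sub>R q s) +
          indicator {w. fst w < snd w} (t, s) *\<^sub>R (p t *\<^sub>R q s))"
      unfolding lower_eq using q i2
      by (intro Bochner_Integration.integral_add[symmetric] integrable_indicator_lessThan) auto
    also have "\<dots> = (LINT s|?M. p t *\<^sub>R q s)"
    proof (rule integral_cong_AE)
      show "AE s in ?M. indicator {..<t} s *\<^sub>R (p t *\<^sub>R q s) +
          indicator {w. fst w < snd w} (t, s) *\<^sub>R (p t *\<^sub>R q s) = p t *\<^sub>R q s"
        using AE_lebesgue_on_neq[of t 0 T] by eventually_elim (auto simp: indicator_def)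
      show "(\<lambda>s. indicator {..<t} s *\<^sub>R (p t *\<^sub>R q s) +
          indicator {w. fst w < snd w} (t, s) *\<^sub>R (p t *\<^sub>R q s)) \<in> borel_measurable ?M"
        using q by (intro borel_measurable_integrable Bochner_Integration.integrable_add i2
          integrable_indicator_lessThan) auto
    qed (use q in auto)
    finally show ?thesis by simp
  qed
  have snd_int: "integrable ?M (\<lambda>t. LINT s|?M. indicator {w. fst w < snd w} (t, s) *\<^sub>R (p t *\<^sub>R q s))"
    using P.integrable_fst[OF upper] .
  have "(LINT t|?M. p t *\<^sub>R primitive T q t) = (LINT t|?M. p t *\<^sub>R (LINT s|?M. q s) -
      (LINT s|?M. indicator {w. fst w < snd w} (t, s) *\<^sub>R (p t *\<^sub>R q s)))"
    by (simp add: split[symmetric])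
  also have "\<dots> = (LINT t|?M. p t) *\<^sub>R (LINT s|?M. q s) -
      (LINT t|?M. LINT s|?M. indicator {w. fst w < snd w} (t, s) *\<^sub>R (p t *\<^sub>R q s))"
    using p snd_int by (subst Bochner_Integration.integral_diff) auto
  also have "(LINT t|?M. LINT s|?M. indicator {w. fst w < snd w} (t, s) *\<^sub>R (p t *\<^sub>R q s)) =
      (LINT s|?M. primitive T p s *\<^sub>R q s)"
    unfolding upper_eq by (rule P.Fubini_integral[OF upper, symmetric])
  finally show ?thesis .
qed

lemma test_functionD:
  assumes "test_function T \<phi>"
  obtains D where "continuous_on UNIV D" "\<And>t. (\<phi> has_vector_derivative D t) (at t)"
    "deriv \<phi> = D" "\<phi> 0 = 0" "\<phi> T = 0"
proof -
  from assms obtain D where D: "continuous_on UNIV D" "\<And>t. (\<phi> has_vector_derivative D t) (at t)"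
    unfolding test_function_def C1_differentiable_on_def by auto
  moreover have "deriv \<phi> = D"
    using D(2) by (intro ext DERIV_imp_deriv) (simp add: has_real_derivative_iff_has_vector_derivative)
  moreover have "\<phi> t = 0" if "t \<notin> {0<..<T}" for t
    using assms that closure_subset[of "{t. \<phi> t \<noteq> 0}"] unfolding test_function_def by blast
  then have "\<phi> 0 = 0" "\<phi> T = 0" by auto
  ultimately show ?thesis using that by blast
qed

lemma L_infty_test_function:
  assumes "test_function T \<phi>"
  shows "L_infty T \<phi>" "L_infty T (deriv \<phi>)"
proof -
  from test_functionD[OF assms] obtain D where D: "continuous_on UNIV D"
    "\<And>t. (\<phi> has_vector_derivative D t) (at t)" "deriv \<phi> = D" by metis
  have "continuous_on UNIV \<phi>"
    using D(2) by (auto intro!: continuous_at_imp_continuous_on has_vector_derivative_continuous)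
  then show "L_infty T \<phi>"
    by (intro L_infty_continuous) (rule continuous_on_subset, auto)
  show "L_infty T (deriv \<phi>)"
    unfolding D(3) by (intro L_infty_continuous continuous_on_subset[OF D(1)]) auto
qed

text \<open>Integration by parts against \<open>deriv \<phi>\<close>, whose primitive is \<open>\<phi>\<close>; the boundary term is
a multiple of \<open>\<phi> T = 0\<close>.\<close>
lemma has_weak_derivative_primitive:
  assumes "0 \<le> T" and q: "integrable (lebesgue_on {0..T}) q"
  shows "has_weak_derivative T (primitive T q) q"
  unfolding has_weak_derivative_def
proof (intro allI impI)
  fix \<phi> assume \<phi>: "test_function T \<phi>"
  from test_functionD[OF this] obtain D where D: "continuous_on UNIV D"
    "\<And>t. (\<phi> has_vector_derivative D t) (at t)" "deriv \<phi> = D" "\<phi> 0 = 0" "\<phi> T = 0" by metis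
  have int: "integrable (lebesgue_on {0..T}) D"
    using L_infty_integrable[OF L_infty_test_function(2)[OF \<phi>]] D(3) by simp
  have prim: "primitive T D t = \<phi> t" if "t \<in> {0..T}" for t
  proof -
    have "(D has_integral \<phi> t - \<phi> 0) {0..t}"
      using that D(2) by (intro fundamental_theorem_of_calculus)
        (auto intro: has_vector_derivative_at_within)
    then show ?thesis
      using primitive_eq_integral[OF int that] D(4) by (simp add: integral_unique)
  qed
  have zero: "(LINT t|lebesgue_on {0..T}. D t) = 0"
    using primitive_at_end[OF int] prim[of T] \<open>0 \<le> T\<close> D(5) by simp
  have "(LINT t|lebesgue_on {0..T}. deriv \<phi> t *\<^sub>R primitive T q t) =
      - (LINT t|lebesgue_on {0..T}. primitive T D t *\<^sub>R q t)"
    using integration_by_parts_primitive[OF int q] by (simp add: D(3) zero)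
  also have "(LINT t|lebesgue_on {0..T}. primitive T D t *\<^sub>R q t) =
      (LINT t|lebesgue_on {0..T}. \<phi> t *\<^sub>R q t)"
    by (rule Bochner_Integration.integral_cong) (auto simp: prim)
  finally show "(LINT t|lebesgue_on {0..T}. deriv \<phi> t *\<^sub>R primitive T q t) =
      - (LINT t|lebesgue_on {0..T}. \<phi> t *\<^sub>R q t)" .
qed

lemma has_weak_derivative_add_scaleR:
  assumes "L_infty T x" "L_infty T g" "has_weak_derivative T x g"
    and "L_infty T z" "L_infty T k" "has_weak_derivative T z k"
  shows "has_weak_derivative T (\<lambda>t. x t + c *\<^sub>R z t) (\<lambda>t. g t + c *\<^sub>R k t)"
  unfolding has_weak_derivative_def
proof (intro allI impI)
  fix \<phi> assume \<phi>: "test_function T \<phi>"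
  note int = L_infty_integrable[OF L_infty_scaleR[OF L_infty_test_function(1)[OF \<phi>]]]
    L_infty_integrable[OF L_infty_scaleR[OF L_infty_test_function(2)[OF \<phi>]]]
  have split: "(LINT t|lebesgue_on {0..T}. \<psi> t *\<^sub>R (y t + c *\<^sub>R w t)) =
      (LINT t|lebesgue_on {0..T}. \<psi> t *\<^sub>R y t) + c *\<^sub>R (LINT t|lebesgue_on {0..T}. \<psi> t *\<^sub>R w t)"
    if "integrable (lebesgue_on {0..T}) (\<lambda>t. \<psi> t *\<^sub>R y t)"
      "integrable (lebesgue_on {0..T}) (\<lambda>t. \<psi> t *\<^sub>R w t)" for \<psi> and y w :: "real \<Rightarrow> 'a"
  proof -
    have "(LINT t|lebesgue_on {0..T}. \<psi> t *\<^sub>R (y t + c *\<^sub>R w t)) =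
      (LINT t|lebesgue_on {0..T}. \<psi> t *\<^sub>R y t + c *\<^sub>R (\<psi> t *\<^sub>R w t))"
      by (simp add: scaleR_add_right mult.commute)
    also have "\<dots> = (LINT t|lebesgue_on {0..T}. \<psi> t *\<^sub>R y t) +
        (LINT t|lebesgue_on {0..T}. c *\<^sub>R (\<psi> t *\<^sub>R w t))"
      using that by (intro Bochner_Integration.integral_add integrable_scaleR_right)
    finally show ?thesis by (simp only: integral_scaleR_right)
  qed
  show "(LINT t|lebesgue_on {0..T}. deriv \<phi> t *\<^sub>R (x t + c *\<^sub>R z t)) =
      - (LINT t|lebesgue_on {0..T}. \<phi> t *\<^sub>R (g t + c *\<^sub>R k t))"
    using assms(3,6) \<phi> unfolding has_weak_derivative_def
    by (simp add: split int assms)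
qed

lemma has_weak_derivative_cong:
  assumes "\<And>t. t \<in> {0..T} \<Longrightarrow> x t = x' t" "\<And>t. t \<in> {0..T} \<Longrightarrow> g t = g' t"
  shows "has_weak_derivative T x g \<longleftrightarrow> has_weak_derivative T x' g'"
proof -
  have "(LINT t|lebesgue_on {0..T}. c t *\<^sub>R x t) = (LINT t|lebesgue_on {0..T}. c t *\<^sub>R x' t)"
    "(LINT t|lebesgue_on {0..T}. c t *\<^sub>R g t) = (LINT t|lebesgue_on {0..T}. c t *\<^sub>R g' t)"
    for c :: "real \<Rightarrow> real"
    by (rule Bochner_Integration.integral_cong; simp add: assms)+
  then show ?thesis by (simp add: has_weak_derivative_def)
qed

section \<open>Solutions of linear differential equations with bounded right-hand side\<close>

text \<open>The solution is the Neumann series \<open>\<Sum>k. Y k\<close>, where \<open>Y 0 = y\<close> and \<open>Y (Suc k)\<close> is the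
primitive of \<open>A \<circ> Y k\<close>. The bound \<open>M * (K * t) ^ k / k!\<close> on its terms makes it converge
uniformly, so that it may be integrated term by term, and it bounds the sum by an exponential.\<close>
lemma linear_volterra_solution:
  fixes A :: "'a::euclidean_space \<Rightarrow> 'a" and y :: "real \<Rightarrow> 'a"
  assumes "bounded_linear A" and K: "0 \<le> K" "\<And>v. norm (A v) \<le> K * norm v"
    and y: "continuous_on {0..T} y" "\<And>t. t \<in> {0..T} \<Longrightarrow> norm (y t) \<le> M"
  obtains r where "continuous_on {0..T} r"
    "\<And>t. t \<in> {0..T} \<Longrightarrow> r t = y t + integral {0..t} (\<lambda>s. A (r s))"
    "\<And>t. t \<in> {0..T} \<Longrightarrow> norm (r t) \<le> M * exp (K * T)"
proof -
  interpret A: bounded_linear A by fact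
  define Y where "Y = rec_nat y (\<lambda>_ f t. integral {0..t} (\<lambda>s. A (f s)))"
  have Y0: "Y 0 = y" and YS: "Y (Suc k) t = integral {0..t} (\<lambda>s. A (Y k s))" for k t
    by (simp_all add: Y_def)
  have contY: "continuous_on {0..T} (Y k)" for k
  proof (induction k)
    case (Suc k)
    then have "(\<lambda>s. A (Y k s)) integrable_on {0..T}"
      by (intro integrable_continuous_interval A.continuous_on)
    then show ?case unfolding YS by (rule indefinite_integral_continuous_1)
  qed (simp add: Y0 y)
  have contAY: "continuous_on {0..t} (\<lambda>s. A (Y k s))" if "t \<in> {0..T}" for t k
    using that by (intro A.continuous_on continuous_on_subset[OF contY]) auto
  have bound: "norm (Y k t) \<le> M * (K ^ k * t ^ k / fact k)" if "t \<in> {0..T}" for k t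
    using that
  proof (induction k arbitrary: t)
    case 0 then show ?case using y by (simp add: Y0)
  next
    case (Suc k)
    have "((\<lambda>s. M * K ^ Suc k / fact k * s ^ k) has_integral
        M * K ^ Suc k / fact (Suc k) * t ^ Suc k - M * K ^ Suc k / fact (Suc k) * 0 ^ Suc k) {0..t}"
    proof (rule fundamental_theorem_of_calculus)
      fix s :: real
      have "((\<lambda>s. M * K ^ Suc k / fact (Suc k) * s ^ Suc k) has_real_derivative
          M * K ^ Suc k / fact (Suc k) * (real (Suc k) * s ^ k)) (at s within {0..t})"
        by (auto intro!: derivative_eq_intros simp del: fact_Suc power_Suc)
      also have "M * K ^ Suc k / fact (Suc k) * (real (Suc k) * s ^ k) = M * K ^ Suc k / fact k * s ^ k"
        by (simp add: fact_Suc del: of_nat_Suc power_Suc)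
      finally show "((\<lambda>s. M * K ^ Suc k / fact (Suc k) * s ^ Suc k) has_vector_derivative
          M * K ^ Suc k / fact k * s ^ k) (at s within {0..t})"
        by (simp add: has_real_derivative_iff_has_vector_derivative)
    qed (use Suc.prems in auto)
    then have I: "((\<lambda>s. M * K ^ Suc k / fact k * s ^ k) has_integral
        M * (K ^ Suc k * t ^ Suc k / fact (Suc k))) {0..t}" by (simp add: mult.assoc)
    have "norm (Y (Suc k) t) \<le> integral {0..t} (\<lambda>s. M * K ^ Suc k / fact k * s ^ k)"
      unfolding YS
    proof (rule integral_norm_bound_integral)
      show "(\<lambda>s. A (Y k s)) integrable_on {0..t}"
        by (intro integrable_continuous_interval contAY Suc.prems)
      show "(\<lambda>s. M * K ^ Suc k / fact k * s ^ k) integrable_on {0..t}"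
        using I by blast
      fix s assume s: "s \<in> {0..t}"
      have "norm (A (Y k s)) \<le> K * norm (Y k s)" by (rule K)
      also have "\<dots> \<le> K * (M * (K ^ k * s ^ k / fact k))"
        using s Suc K(1) by (intro mult_left_mono) auto
      finally show "norm (A (Y k s)) \<le> M * K ^ Suc k / fact k * s ^ k"
        by (simp add: field_simps)
    qed
    then show ?case by (simp only: integral_unique[OF I])
  qed
  have M: "0 \<le> M" if "0 \<le> T"
    using order_trans[OF norm_ge_zero y(2)[of 0]] that by simp
  have bound': "norm (Y k t) \<le> M * (K * T) ^ k / fact k" if "t \<in> {0..T}" for k t
  proof -
    have "M * (K ^ k * t ^ k / fact k) \<le> M * (K ^ k * T ^ k / fact k)"
      using that M K(1) by (intro mult_left_mono divide_right_mono power_mono) auto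
    then show ?thesis using bound[OF that, of k] by (simp add: power_mult_distrib)
  qed
  have exp_sums: "(\<lambda>k. M * (K * T) ^ k / fact k) sums (M * exp (K * T))"
    using sums_mult[OF exp_converges[of "K * T"], of M] by (simp add: divide_inverse mult_ac)
  define r where "r t = (\<Sum>k. Y k t)" for t
  have lim: "uniform_limit {0..T} (\<lambda>n t. \<Sum>k<n. Y k t) r sequentially"
    unfolding r_def using bound' sums_summable[OF exp_sums] by (rule Weierstrass_m_test)
  have cont_sum: "continuous_on {0..T} (\<lambda>t. \<Sum>k<n. Y k t)" for n
    by (intro continuous_intros contY)
  show thesis
  proof
    show contr: "continuous_on {0..T} r"
      by (rule uniform_limit_theorem[OF _ lim]) (auto intro!: always_eventually cont_sum)
    fix t assume t: "t \<in> {0..T}"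
    have "uniform_limit {0..t} (\<lambda>n s. A (\<Sum>k<n. Y k s)) (\<lambda>s. A (r s)) sequentially"
      using t by (intro A.uniform_limit uniform_limit_on_subset[OF lim]) auto
    moreover have "continuous_on {0..t} (\<lambda>s. A (\<Sum>k<n. Y k s))" for n
      using t by (intro A.continuous_on continuous_on_subset[OF cont_sum]) auto
    ultimately obtain I J where IJ: "\<And>n. ((\<lambda>s. A (\<Sum>k<n. Y k s)) has_integral I n) {0..t}"
      "((\<lambda>s. A (r s)) has_integral J) {0..t}" "I \<longlonglongrightarrow> J"
      by (rule uniform_limit_integral) auto
    have "I n = (\<Sum>k<n. Y (Suc k) t)" for n
    proof -
      have "I n = integral {0..t} (\<lambda>s. \<Sum>k<n. A (Y k s))"
        using IJ(1)[of n] by (simp add: integral_unique A.sum)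
      also have "\<dots> = (\<Sum>k<n. integral {0..t} (\<lambda>s. A (Y k s)))"
        using t by (intro integral_sum integrable_continuous_interval contAY) auto
      finally show ?thesis by (simp add: YS)
    qed
    then have "I = (\<lambda>n. \<Sum>k<n. Y (Suc k) t)" by (rule ext)
    then have "(\<lambda>k. Y (Suc k) t) sums J"
      using IJ(3) by (simp add: sums_def)
    then have "(\<lambda>k. Y k t) sums (J + Y 0 t)" by (rule sums_Suc)
    then show "r t = y t + integral {0..t} (\<lambda>s. A (r s))"
      using IJ(2) by (simp add: r_def sums_iff integral_unique Y0)
    have "norm (r t) \<le> (\<Sum>k. M * (K * T) ^ k / fact k)"
      unfolding r_def using bound'[OF t] sums_summable[OF exp_sums] by (rule norm_suminf_le)
    then show "norm (r t) \<le> M * exp (K * T)"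
      using exp_sums by (simp add: sums_iff)
  qed
qed

lemma matrix_vector_mult_bound:
  fixes A :: "real ^ 'a ^ 'b"
  obtains K where "0 \<le> K" "\<And>v. norm (A *v v) \<le> K * norm v"
  using bounded_linear.nonneg_bounded[OF matrix_vector_mul_bounded_linear[of A]]
  by (auto simp: mult.commute)

text \<open>Write \<open>P\<close> for the primitive of the forcing \<open>p\<close>. Subtracting \<open>P\<close> from the response removes
the merely measurable forcing: \<open>r = z - P\<close> solves a Volterra equation with the continuous
inhomogeneity \<open>\<integral> A P\<close>. If \<open>P\<close> has returned to \<open>0\<close> by time \<open>h\<close>, this inhomogeneity is of
size \<open>h\<close> for all times, and hence so is \<open>r\<close>: the response is the path \<open>P\<close> itself up to an
error of order \<open>h\<close>.\<close>
lemma linear_ode_response: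
  fixes A :: "real ^ 'n ^ 'n" and p :: "real \<Rightarrow> real ^ 'n"
  assumes T: "0 \<le> T" and K: "0 \<le> K" "\<And>v. norm (A *v v) \<le> K * norm v"
    and p: "L_infty T p"
    and bound: "\<And>t. norm (primitive T p t) \<le> M" and rest: "\<And>t. h \<le> t \<Longrightarrow> primitive T p t = 0"
    and h: "0 < h" "h \<le> T"
  obtains z r where "continuous_on {0..T} z" "z 0 = 0"
    "has_weak_derivative T z (\<lambda>t. A *v z t + p t)"
    "continuous_on {0..T} r"
    "\<And>t. t \<in> {0..T} \<Longrightarrow> z t = r t + primitive T p t"
    "\<And>t. t \<in> {0..T} \<Longrightarrow> norm (r t) \<le> K * M * exp (K * T) * h"
proof -
  let ?P = "primitive T p"
  have contP: "continuous_on {0..T} ?P"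
    by (intro continuous_on_primitive L_infty_integrable p)
  have contAP: "continuous_on {0..T} (\<lambda>s. A *v ?P s)"
    by (rule bounded_linear.continuous_on[OF matrix_vector_mul_bounded_linear contP])
  have intAP: "(\<lambda>s. A *v ?P s) integrable_on {a..b}" if "0 \<le> a" "b \<le> T" for a b
    using that by (intro integrable_continuous_interval continuous_on_subset[OF contAP]) auto
  define y where "y t = integral {0..t} (\<lambda>s. A *v ?P s)" for t
  have "continuous_on {0..T} y"
    unfolding y_def by (intro indefinite_integral_continuous_1 intAP) auto
  moreover have "norm (y t) \<le> K * M * h" if "t \<in> {0..T}" for t
  proof -
    have AP: "norm (A *v ?P s) \<le> K * M" for s
      using K(2)[of "?P s"] mult_left_mono[OF bound K(1), of s] by linarith
    then have KM: "0 \<le> K * M" by (rule order_trans[OF norm_ge_zero])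
    have "y t = y (min t h)"
    proof (cases "h \<le> t")
      case True
      have "y t = y h + integral {h..t} (\<lambda>s. A *v ?P s)"
        unfolding y_def using True that h
        by (intro Henstock_Kurzweil_Integration.integral_combine[symmetric] intAP) auto
      also have "integral {h..t} (\<lambda>s. A *v ?P s) = integral {h..t} (\<lambda>s. 0)"
        by (rule Henstock_Kurzweil_Integration.integral_cong) (simp add: rest)
      finally show ?thesis using True by (simp add: min_absorb2)
    qed (simp add: min_def)
    moreover have "norm (y (min t h)) \<le> K * M * (min t h - 0)"
      unfolding y_def using that h AP
      by (intro integral_bound continuous_on_subset[OF contAP]) auto
    moreover have "K * M * (min t h - 0) \<le> K * M * h"
      using KM by (intro mult_left_mono) auto
    ultimately show ?thesis by simp
  qed
  ultimately obtain r where r: "continuous_on {0..T} r"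
    "\<And>t. t \<in> {0..T} \<Longrightarrow> r t = y t + integral {0..t} (\<lambda>s. A *v r s)"
    "\<And>t. t \<in> {0..T} \<Longrightarrow> norm (r t) \<le> K * M * h * exp (K * T)"
    using linear_volterra_solution[OF matrix_vector_mul_bounded_linear K] by blast
  define z where "z t = r t + ?P t" for t
  have contz: "continuous_on {0..T} z"
    unfolding z_def by (intro continuous_intros r contP)
  have contAz: "continuous_on {0..T} (\<lambda>s. A *v z s)"
    by (rule bounded_linear.continuous_on[OF matrix_vector_mul_bounded_linear contz])
  note intAz = L_infty_integrable[OF L_infty_continuous[OF contAz]]
  have z_eq: "z t = primitive T (\<lambda>t. A *v z t + p t) t" if t: "t \<in> {0..T}" for t
  proof -
    have "continuous_on {0..T} (\<lambda>s. A *v r s)"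
      by (rule bounded_linear.continuous_on[OF matrix_vector_mul_bounded_linear r(1)])
    then have "(\<lambda>s. A *v r s) integrable_on {0..t}"
      using t by (intro integrable_continuous_interval) (rule continuous_on_subset, auto)
    then have "r t = integral {0..t} (\<lambda>s. A *v z s)"
      using r(2)[OF t] t intAP[of 0 t]
      by (simp add: y_def z_def matrix_vector_right_distrib add.commute
          Henstock_Kurzweil_Integration.integral_add)
    then show ?thesis
      using primitive_eq_integral[OF intAz t]
      by (simp add: z_def[of t] primitive_add intAz L_infty_integrable p)
  qed
  have "has_weak_derivative T (primitive T (\<lambda>t. A *v z t + p t)) (\<lambda>t. A *v z t + p t)"
    by (intro has_weak_derivative_primitive T Bochner_Integration.integrable_add intAz
        L_infty_integrable p)
  then have "has_weak_derivative T z (\<lambda>t. A *v z t + p t)"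
    by (subst has_weak_derivative_cong[OF z_eq refl])
  moreover have "z 0 = 0"
    using r(2)[of 0] T by (simp add: z_def y_def primitive_eq_integral L_infty_integrable p)
  moreover have "norm (r t) \<le> K * M * exp (K * T) * h" if "t \<in> {0..T}" for t
    using r(3)[OF that] by (simp add: mult_ac)
  ultimately show thesis
    using that[of z r] contz r(1) z_def by blast
qed

section \<open>Controls that trace a loop in a plane\<close>

text \<open>The normalisation gives every pulse integral \<open>1\<close>, however little of \<open>E\<close> lies in the interval.
The resulting large heights are harmless, because only the sign of a form homogeneous of degree
two in the controls will matter.\<close>

definition pulse :: "real set \<Rightarrow> real \<Rightarrow> real \<Rightarrow> real \<Rightarrow> real" where
  "pulse E c d t = indicator (E \<inter> {c..<d}) t / measure lebesgue (E \<inter> {c..<d})"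

lemma pulse_nonneg: "0 \<le> pulse E c d t"
  by (simp add: pulse_def)

lemma pulse_nonzero: "pulse E c d t \<noteq> 0 \<Longrightarrow> t \<in> E \<and> c \<le> t \<and> t < d"
  by (auto simp: pulse_def indicator_def split: if_splits)

lemma L_infty_pulse:
  assumes "E \<in> sets lebesgue"
  shows "L_infty T (pulse E c d)"
proof (rule L_infty_bounded)
  show "pulse E c d \<in> borel_measurable (lebesgue_on {0..T})"
    unfolding pulse_def
    by (intro measurable_restrict_space1 borel_measurable_divide borel_measurable_indicator
        borel_measurable_const sets.Int assms) simp
  show "norm (pulse E c d t) \<le> 1 / measure lebesgue (E \<inter> {c..<d})" for t
    by (auto simp: pulse_def indicator_def)
qed

lemma integral_pulse:
  assumes "E \<in> sets lebesgue" "0 \<le> c" "d \<le> T" "0 < measure lebesgue (E \<inter> {c..<d})"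
  shows "(LINT t|lebesgue_on {0..T}. pulse E c d t) = 1"
proof -
  have "measure (lebesgue_on {0..T}) (E \<inter> {c..<d}) = measure lebesgue (E \<inter> {c..<d})"
    using assms by (intro measure_restrict_space) auto
  moreover have "E \<inter> {c..<d} \<inter> {0..T} = E \<inter> {c..<d}" using assms by auto
  ultimately show ?thesis
    using assms by (simp add: pulse_def Int_assoc)
qed

lemma primitive_pulse:
  assumes E: "E \<in> sets lebesgue" "0 \<le> c" "d \<le> T" "0 < measure lebesgue (E \<inter> {c..<d})"
  shows primitive_pulse_before: "t \<le> c \<Longrightarrow> primitive T (pulse E c d) t = 0"
    and primitive_pulse_after: "d \<le> t \<Longrightarrow> primitive T (pulse E c d) t = 1"
    and primitive_pulse_nonneg: "0 \<le> primitive T (pulse E c d) t"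
    and primitive_pulse_le_1: "primitive T (pulse E c d) t \<le> 1"
proof -
  note int = L_infty_integrable[OF L_infty_pulse[OF E(1), of T c d]]
  show "primitive T (pulse E c d) t = 0" if "t \<le> c"
  proof -
    have *: "indicator {..<t} s *\<^sub>R pulse E c d s = 0" for s
      using that pulse_nonzero[of E c d s] by (cases "pulse E c d s = 0") auto
    show ?thesis unfolding primitive_def * by simp
  qed
  show "primitive T (pulse E c d) t = 1" if "d \<le> t"
  proof -
    have *: "indicator {..<t} s *\<^sub>R pulse E c d s = pulse E c d s" for s
      using that pulse_nonzero[of E c d s] by (cases "pulse E c d s = 0") auto
    show ?thesis unfolding primitive_def * by (rule integral_pulse[OF E])
  qed
  show "0 \<le> primitive T (pulse E c d) t"
    unfolding primitive_def
    by (intro Bochner_Integration.integral_nonneg) (simp add: pulse_nonneg)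
  have "primitive T (pulse E c d) t \<le> (LINT t|lebesgue_on {0..T}. pulse E c d t)"
    unfolding primitive_def
    by (intro Bochner_Integration.integral_mono integrable_indicator_lessThan int)
      (simp add: indicator_def pulse_nonneg)
  then show "primitive T (pulse E c d) t \<le> 1" by (simp add: integral_pulse[OF E])
qed

text \<open>Controls vanishing off \<open>E\<close> whose primitives \<open>(f, g)\<close> run along a closed curve in the
square \<open>[-1,1]\<^sup>2\<close> and are back at the origin by time \<open>h\<close>. The last conjunct states that the oriented area
\<open>\<integral> f dg\<close> enclosed by this curve is \<open>1\<close>; it does not shrink with \<open>h\<close>.\<close>
definition loop_controls :: "real \<Rightarrow> real \<Rightarrow> real set \<Rightarrow> (real \<Rightarrow> real) \<Rightarrow> (real \<Rightarrow> real) \<Rightarrow> bool" where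
  "loop_controls T h E \<alpha> \<beta> \<longleftrightarrow>
     L_infty T \<alpha> \<and> L_infty T \<beta> \<and>
     (\<forall>t. t \<notin> E \<longrightarrow> \<alpha> t = 0 \<and> \<beta> t = 0) \<and>
     (\<forall>t. \<bar>primitive T \<alpha> t\<bar> \<le> 1 \<and> \<bar>primitive T \<beta> t\<bar> \<le> 1) \<and>
     (\<forall>t\<ge>h. primitive T \<alpha> t = 0 \<and> primitive T \<beta> t = 0) \<and>
     (LINT t|lebesgue_on {0..T}. \<bar>\<alpha> t\<bar>) \<le> 2 \<and> (LINT t|lebesgue_on {0..T}. \<bar>\<beta> t\<bar>) \<le> 2 \<and>
     (LINT t|lebesgue_on {0..T}. primitive T \<alpha> t * \<beta> t) = 1"

text \<open>The curve is the boundary of the unit square: on the four quarters of \<open>[0,h)\<close>, the pulses move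
\<open>f\<close> up, \<open>g\<close> up, \<open>f\<close> down and \<open>g\<close> down.\<close>
lemma loop_controls_exist:
  assumes E: "E \<in> sets lebesgue" and h: "0 < h" "h \<le> T"
    and pos: "\<And>i. i < 4 \<Longrightarrow> 0 < measure lebesgue (E \<inter> {real i * h / 4..<real (Suc i) * h / 4})"
  shows "\<exists>\<alpha> \<beta>. loop_controls T h E \<alpha> \<beta>"
proof -
  define p where "p i = pulse E (real i * h / 4) (real (Suc i) * h / 4)" for i
  have end_le: "real (Suc i) * h / 4 \<le> h" if "i < 4" for i
    using that h mult_right_mono[of "real (Suc i)" 4 h] by simp
  have mono: "real i * h / 4 \<le> real j * h / 4" if "i \<le> j" for i j
    using that h by (simp add: mult_right_mono)
  have L: "L_infty T (p i)" for i
    unfolding p_def by (rule L_infty_pulse[OF E])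
  note int = L_infty_integrable[OF L]
  have P: "0 \<le> real i * h / 4" "real (Suc i) * h / 4 \<le> T"
      "0 < measure lebesgue (E \<inter> {real i * h / 4..<real (Suc i) * h / 4})" if "i < 4" for i
    using order_trans[OF end_le[OF that] h(2)] h pos[OF that] by (simp_all del: of_nat_Suc)
  have ip: "(LINT t|lebesgue_on {0..T}. p i t) = 1" if "i < 4" for i
    unfolding p_def by (rule integral_pulse[OF E P[OF that]])
  have before: "primitive T (p i) t = 0" if "i < 4" "t \<le> real i * h / 4" for i t
    unfolding p_def by (rule primitive_pulse_before[OF E P[OF that(1)] that(2)])
  have after: "primitive T (p i) t = 1" if "i < 4" "real (Suc i) * h / 4 \<le> t" for i t
    unfolding p_def by (rule primitive_pulse_after[OF E P[OF that(1)] that(2)])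
  have range: "0 \<le> primitive T (p i) t" "primitive T (p i) t \<le> 1" if "i < 4" for i t
    unfolding p_def
    by (rule primitive_pulse_nonneg[OF E P[OF that]] primitive_pulse_le_1[OF E P[OF that]])+
  have supp: "p i t = 0 \<or> t \<in> E \<and> real i * h / 4 \<le> t \<and> t < real (Suc i) * h / 4" for i t
    unfolding p_def using pulse_nonzero by blast
  have off: "p i t = 0" if "t \<notin> E" for i t
    using supp[of i t] that by blast
  have nonneg: "0 \<le> p i t" for i t unfolding p_def by (rule pulse_nonneg)
  define \<alpha> where "\<alpha> t = p 0 t - p 2 t" for t
  define \<beta> where "\<beta> t = p 1 t - p 3 t" for t
  have prim_diff: "primitive T (\<lambda>t. p i t - p j t) t = primitive T (p i) t - primitive T (p j) t" for i j t
    by (rule primitive_diff[OF int int])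
  have L_diff: "L_infty T (\<lambda>t. p i t - p j t)" for i j
    using L_infty_add[OF L[of i] L_infty_scaleR[OF L_infty_const[of T "-1"] L[of j]]] by simp
  have abs_bound: "(LINT t|lebesgue_on {0..T}. \<bar>p i t - p j t\<bar>) \<le> 2" if "i < 4" "j < 4" for i j
  proof -
    have "(LINT t|lebesgue_on {0..T}. \<bar>p i t - p j t\<bar>) \<le> (LINT t|lebesgue_on {0..T}. p i t + p j t)"
    proof (rule Bochner_Integration.integral_mono)
      show "\<bar>p i t - p j t\<bar> \<le> p i t + p j t" for t
        using nonneg[of i t] nonneg[of j t] by linarith
    qed (intro integrable_abs Bochner_Integration.integrable_diff
          Bochner_Integration.integrable_add int)+
    then show ?thesis using ip that int by simp
  qed
  have prim_bound: "\<bar>primitive T (p i) t - primitive T (p j) t\<bar> \<le> 1" if "i < 4" "j < 4" for i j t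
    using range[OF that(1), of t] range[OF that(2), of t] by linarith
  have closed: "primitive T (p i) t - primitive T (p j) t = 0" if "i < 4" "j < 4" "h \<le> t" for i j t
    using after[of i t] after[of j t] end_le[of i] end_le[of j] that by simp
  \<comment> \<open>When \<open>g\<close> rises, \<open>f\<close> is at \<open>1\<close>; when \<open>g\<close> falls, \<open>f\<close> is back at \<open>0\<close>.\<close>
  have "primitive T \<alpha> t * \<beta> t = p 1 t" for t
  proof -
    have "p 1 t = 0 \<or> primitive T (p 0) t - primitive T (p 2) t = 1"
      using supp[of 1 t] after[of 0 t] before[of 2 t] by auto
    moreover have "p 3 t = 0 \<or> primitive T (p 0) t - primitive T (p 2) t = 0"
      using supp[of 3 t] after[of 0 t] after[of 2 t] h by auto
    ultimately show ?thesis
      unfolding \<alpha>_def \<beta>_def prim_diff by auto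
  qed
  then have "(LINT t|lebesgue_on {0..T}. primitive T \<alpha> t * \<beta> t) = 1"
    by (simp add: ip)
  then have "loop_controls T h E \<alpha> \<beta>"
    unfolding loop_controls_def \<alpha>_def \<beta>_def prim_diff
    using L_diff abs_bound prim_bound closed off by auto
  then show ?thesis by blast
qed

section \<open>The second variation along a short loop\<close>

text \<open>The response to \<open>v = \<alpha> a + \<beta> b\<close> is \<open>z = r + G w\<close> with \<open>w = f a + g b\<close> and \<open>r\<close> of order \<open>h\<close>.
The term in \<open>Y\<close> is of order \<open>h\<close>, since \<open>G w\<close> lives on a time interval of length \<open>h\<close>, and so is
the contribution of \<open>r\<close> to the term in \<open>N\<close>, since \<open>v\<close> has bounded \<open>L\<^sup>1\<close> norm. What remains
is \<open>\<integral> \<omega>(w, w')\<close> for the bilinear form \<open>\<omega> p q = (C G p) \<bullet> (N q)\<close>; along a closed curve the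
symmetric part of \<open>\<omega>\<close> integrates to zero, and the antisymmetric part gives \<open>\<omega> a b - \<omega> b a\<close>
times the enclosed area, which is \<open>1\<close>. The constant \<open>c\<close> has to be independent of \<open>h\<close> and of
\<open>E\<close>.\<close>
lemma loop_response_cost:
  fixes A :: "real ^ 'n ^ 'n" and G :: "real ^ 'm ^ 'n" and C :: "real ^ 'n ^ 'm"
    and Y N :: "real ^ 'm ^ 'm" and a b :: "real ^ 'm"
  assumes T: "0 < T"
  obtains c where "\<And>h E \<alpha> \<beta>. 0 < h \<Longrightarrow> h \<le> T \<Longrightarrow> loop_controls T h E \<alpha> \<beta> \<Longrightarrow>
    \<exists>z. continuous_on {0..T} z \<and> z 0 = 0 \<and>
      has_weak_derivative T z (\<lambda>t. A *v z t + G *v (\<alpha> t *\<^sub>R a + \<beta> t *\<^sub>R b)) \<and>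
      (LINT t|lebesgue_on {0..T}. (C *v z t) \<bullet> (Y *v (C *v z t)) +
         (C *v z t) \<bullet> (N *v (\<alpha> t *\<^sub>R a + \<beta> t *\<^sub>R b)))
      \<le> (C *v (G *v a)) \<bullet> (N *v b) - (C *v (G *v b)) \<bullet> (N *v a) + c * h"
proof -
  obtain KA where KA: "0 \<le> KA" "\<And>v. norm (A *v v) \<le> KA * norm v"
    using matrix_vector_mult_bound[of A] by blast
  obtain KG where KG: "0 \<le> KG" "\<And>v. norm (G *v v) \<le> KG * norm v"
    using matrix_vector_mult_bound[of G] by blast
  obtain KC where KC: "0 \<le> KC" "\<And>v. norm (C *v v) \<le> KC * norm v"
    using matrix_vector_mult_bound[of C] by blast
  obtain KY where KY: "0 \<le> KY" "\<And>v. norm (Y *v v) \<le> KY * norm v"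
    using matrix_vector_mult_bound[of Y] by blast
  obtain KN where KN: "0 \<le> KN" "\<And>v. norm (N *v v) \<le> KN * norm v"
    using matrix_vector_mult_bound[of N] by blast
  define \<omega> where "\<omega> p q = (C *v (G *v p)) \<bullet> (N *v q)" for p q
  define W where "W = norm a + norm b"
  define M where "M = KG * W"
  define k where "k = KA * M * exp (KA * T)"
  define k1 where "k1 = KC * (KY * KC)"
  define k2 where "k2 = KC * KN * k"
  define c where "c = k1 * (2 * k\<^sup>2 * T\<^sup>2 + 2 * M\<^sup>2) + k2 * (2 * W)"
  have W: "0 \<le> W" and M: "0 \<le> M" and k: "0 \<le> k" and k1: "0 \<le> k1" and k2: "0 \<le> k2"
    using KA(1) KG(1) KC(1) KY(1) KN(1) by (simp_all add: W_def M_def k_def k1_def k2_def)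
  show thesis
  proof (rule that)
    fix h E \<alpha> \<beta>
    assume h: "0 < h" "h \<le> T" and "loop_controls T h E \<alpha> \<beta>"
    then have ab: "L_infty T \<alpha>" "L_infty T \<beta>"
      "\<And>t. \<bar>primitive T \<alpha> t\<bar> \<le> 1" "\<And>t. \<bar>primitive T \<beta> t\<bar> \<le> 1"
      "\<And>t. h \<le> t \<Longrightarrow> primitive T \<alpha> t = 0" "\<And>t. h \<le> t \<Longrightarrow> primitive T \<beta> t = 0"
      "(LINT t|lebesgue_on {0..T}. \<bar>\<alpha> t\<bar>) \<le> 2" "(LINT t|lebesgue_on {0..T}. \<bar>\<beta> t\<bar>) \<le> 2"
      "(LINT t|lebesgue_on {0..T}. primitive T \<alpha> t * \<beta> t) = 1"
      by (auto simp: loop_controls_def)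
    define v where "v t = \<alpha> t *\<^sub>R a + \<beta> t *\<^sub>R b" for t
    define f where "f = primitive T \<alpha>"
    define g where "g = primitive T \<beta>"
    define w where "w t = f t *\<^sub>R a + g t *\<^sub>R b" for t
    note ia = L_infty_integrable[OF ab(1)] and ib = L_infty_integrable[OF ab(2)]
    have Lv: "L_infty T v"
      unfolding v_def by (intro L_infty_add L_infty_scaleR ab L_infty_const)
    have LGv: "L_infty T (\<lambda>t. G *v v t)"
      by (rule L_infty_matrix_vector_mult[OF Lv])
    have prim_v: "primitive T v t = w t" for t
    proof -
      have "primitive T v t = primitive T (\<lambda>t. \<alpha> t *\<^sub>R a) t + primitive T (\<lambda>t. \<beta> t *\<^sub>R b) t"
        unfolding v_def using ia ib by (intro primitive_add) auto
      then show ?thesis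
        using primitive_bounded_linear[OF bounded_linear_scaleR_left ia, of a t]
          primitive_bounded_linear[OF bounded_linear_scaleR_left ib, of b t]
        by (simp add: w_def f_def g_def)
    qed
    have prim_Gv: "primitive T (\<lambda>t. G *v v t) t = G *v w t" for t
      using primitive_bounded_linear[OF matrix_vector_mul_bounded_linear L_infty_integrable[OF Lv]]
      by (simp add: prim_v)
    have Gw: "norm (G *v w t) \<le> M" for t
    proof -
      have "norm (w t) \<le> \<bar>f t\<bar> * norm a + \<bar>g t\<bar> * norm b"
        unfolding w_def using norm_triangle_ineq[of "f t *\<^sub>R a" "g t *\<^sub>R b"] by simp
      also have "\<dots> \<le> W"
        unfolding W_def f_def g_def using ab(3,4)[of t]
        by (intro add_mono mult_left_le_one_le) auto
      finally show ?thesis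
        unfolding M_def using KG mult_left_mono order_trans by blast
    qed
    have Gw0: "G *v w t = 0" if "h \<le> t" for t
      using ab(5,6)[OF that] by (simp add: w_def f_def g_def)
    obtain z r where zr: "continuous_on {0..T} z" "z 0 = 0"
      "has_weak_derivative T z (\<lambda>t. A *v z t + G *v v t)" "continuous_on {0..T} r"
      "\<And>t. t \<in> {0..T} \<Longrightarrow> z t = r t + primitive T (\<lambda>t. G *v v t) t"
      "\<And>t. t \<in> {0..T} \<Longrightarrow> norm (r t) \<le> KA * M * exp (KA * T) * h"
    proof (rule linear_ode_response[OF less_imp_le[OF T] KA LGv _ _ h])
      show "norm (primitive T (\<lambda>t. G *v v t) t) \<le> M" for t
        unfolding prim_Gv by (rule Gw)
      show "primitive T (\<lambda>t. G *v v t) t = 0" if "h \<le> t" for t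
        unfolding prim_Gv by (rule Gw0[OF that])
    qed blast
    note z = zr[unfolded prim_Gv, folded k_def]
    have \<omega>_vw: "\<omega> (w t) (v t) = (f t * \<alpha> t) * \<omega> a a + (f t * \<beta> t) * \<omega> a b +
        (g t * \<alpha> t) * \<omega> b a + (g t * \<beta> t) * \<omega> b b" for t
      unfolding \<omega>_def w_def v_def
      by (simp add: matrix_vector_right_distrib matrix_vector_mult_scaleR inner_add algebra_simps)
    have Lf: "L_infty T f" and Lg: "L_infty T g"
      unfolding f_def g_def by (intro L_infty_continuous continuous_on_primitive ia ib)+
    have ints: "integrable (lebesgue_on {0..T}) (\<lambda>t. f t * \<alpha> t)"
      "integrable (lebesgue_on {0..T}) (\<lambda>t. f t * \<beta> t)"
      "integrable (lebesgue_on {0..T}) (\<lambda>t. g t * \<alpha> t)"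
      "integrable (lebesgue_on {0..T}) (\<lambda>t. g t * \<beta> t)"
      using Lf Lg ab(1,2)
      by (auto intro!: L_infty_integrable L_infty_scaleR simp flip: real_scaleR_def)
    have end0: "(LINT t|lebesgue_on {0..T}. \<alpha> t) = 0" "(LINT t|lebesgue_on {0..T}. \<beta> t) = 0"
      using primitive_at_end[OF ia] primitive_at_end[OF ib] ab(5,6)[of T] h by auto
    \<comment> \<open>Integration by parts with vanishing end points: \<open>\<integral> f f' = \<integral> g g' = 0\<close> and
      \<open>\<integral> g f' = - \<integral> f g' = - 1\<close>.\<close>
    have vals: "(LINT t|lebesgue_on {0..T}. f t * \<alpha> t) = 0" "(LINT t|lebesgue_on {0..T}. f t * \<beta> t) = 1"
      "(LINT t|lebesgue_on {0..T}. g t * \<alpha> t) = - 1" "(LINT t|lebesgue_on {0..T}. g t * \<beta> t) = 0"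
      using integration_by_parts_primitive[OF ia ia] integration_by_parts_primitive[OF ib ib]
        integration_by_parts_primitive[OF ia ib] ab(9)
      by (simp_all add: end0 f_def g_def mult.commute)
    have \<omega>_int: "integrable (lebesgue_on {0..T}) (\<lambda>t. \<omega> (w t) (v t))"
      unfolding \<omega>_vw using ints by auto
    have \<omega>_val: "(LINT t|lebesgue_on {0..T}. \<omega> (w t) (v t)) = \<omega> a b - \<omega> b a"
      unfolding \<omega>_vw using ints by (simp add: vals)
    define q where "q t = (C *v z t) \<bullet> (Y *v (C *v z t)) + (C *v z t) \<bullet> (N *v v t)" for t
    \<comment> \<open>Everything except the main term \<open>\<omega> (w t) (v t)\<close>, bounded pointwise; its integral is of order \<open>h\<close>.\<close>
    define e where "e t = k1 * (2 * (k * h)\<^sup>2) + (k1 * (2 * M\<^sup>2)) * (indicator {..<h} t *\<^sub>R 1) +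
        ((k2 * h * norm a) * \<bar>\<alpha> t\<bar> + (k2 * h * norm b) * \<bar>\<beta> t\<bar>)" for t
    have qe: "q t \<le> e t + \<omega> (w t) (v t)" if t: "t \<in> {0..T}" for t
    proof -
      have "norm (z t) ^ 2 \<le> (norm (r t) + norm (G *v w t)) ^ 2"
        using z(5)[OF t] norm_triangle_ineq[of "r t" "G *v w t"] by (intro power_mono) auto
      also have "\<dots> \<le> 2 * norm (r t) ^ 2 + 2 * norm (G *v w t) ^ 2"
        using sum_squares_bound[of "norm (r t)" "norm (G *v w t)"] by (simp add: power2_sum)
      also have "\<dots> \<le> 2 * (k * h)\<^sup>2 + 2 * (M\<^sup>2 * indicator {..<h} t)"
      proof (intro add_mono mult_left_mono)
        show "norm (r t) ^ 2 \<le> (k * h)\<^sup>2" using z(6)[OF t] by (intro power_mono) auto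
        show "norm (G *v w t) ^ 2 \<le> M\<^sup>2 * indicator {..<h} t"
          using Gw[of t] Gw0[of t] by (auto simp: indicator_def intro: power_mono)
      qed auto
      finally have z2: "norm (z t) ^ 2 \<le> 2 * (k * h)\<^sup>2 + 2 * (M\<^sup>2 * indicator {..<h} t)" .
      have "(C *v z t) \<bullet> (Y *v (C *v z t)) \<le> norm (C *v z t) * norm (Y *v (C *v z t))"
        by (rule norm_cauchy_schwarz)
      also have "\<dots> \<le> (KC * norm (z t)) * (KY * (KC * norm (z t)))"
        using KC KY order_trans[OF KY(2) mult_left_mono[OF KC(2) KY(1)]]
        by (intro mult_mono) auto
      also have "\<dots> = k1 * norm (z t) ^ 2" by (simp add: k1_def power2_eq_square)
      also have "\<dots> \<le> k1 * (2 * (k * h)\<^sup>2 + 2 * (M\<^sup>2 * indicator {..<h} t))"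
        by (rule mult_left_mono[OF z2 k1])
      finally have 1: "(C *v z t) \<bullet> (Y *v (C *v z t)) \<le>
        k1 * (2 * (k * h)\<^sup>2 + 2 * (M\<^sup>2 * indicator {..<h} t))" .
      have "(C *v r t) \<bullet> (N *v v t) \<le> norm (C *v r t) * norm (N *v v t)"
        by (rule norm_cauchy_schwarz)
      also have "\<dots> \<le> (KC * (k * h)) * (KN * (\<bar>\<alpha> t\<bar> * norm a + \<bar>\<beta> t\<bar> * norm b))"
      proof (rule mult_mono)
        show "norm (C *v r t) \<le> KC * (k * h)"
          using KC(2)[of "r t"] mult_left_mono[OF z(6)[OF t] KC(1)] by linarith
        have "norm (v t) \<le> \<bar>\<alpha> t\<bar> * norm a + \<bar>\<beta> t\<bar> * norm b"
          unfolding v_def using norm_triangle_ineq[of "\<alpha> t *\<^sub>R a" "\<beta> t *\<^sub>R b"] by simp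
        then show "norm (N *v v t) \<le> KN * (\<bar>\<alpha> t\<bar> * norm a + \<bar>\<beta> t\<bar> * norm b)"
          using KN(2)[of "v t"] mult_left_mono[OF _ KN(1)] by (meson order_trans)
      qed (use KC(1) k h in auto)
      finally have 2: "(C *v r t) \<bullet> (N *v v t) \<le>
        (KC * (k * h)) * (KN * (\<bar>\<alpha> t\<bar> * norm a + \<bar>\<beta> t\<bar> * norm b))" .
      have "q t = (C *v z t) \<bullet> (Y *v (C *v z t)) + (C *v r t) \<bullet> (N *v v t) + \<omega> (w t) (v t)"
        unfolding q_def \<omega>_def z(5)[OF t] by (simp add: matrix_vector_right_distrib inner_add_left)
      with 1 2 show ?thesis
        unfolding e_def k2_def by (simp add: algebra_simps)
    qed
    have LCz: "L_infty T (\<lambda>t. C *v z t)"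
      by (intro L_infty_matrix_vector_mult L_infty_continuous z)
    have "integrable (lebesgue_on {0..T}) q"
      unfolding q_def by (intro L_infty_integrable L_infty_add L_infty_inner LCz
          L_infty_matrix_vector_mult Lv)
    have int_ind: "integrable (lebesgue_on {0..T}) (\<lambda>t. indicator {..<h} t *\<^sub>R (1::real))"
      by (intro integrable_indicator_lessThan) simp
    have e_int: "integrable (lebesgue_on {0..T}) e"
      unfolding e_def using int_ind ia ib
      by (intro Bochner_Integration.integrable_add integrable_mult_right integrable_abs) auto
    have ind_val: "(LINT t|lebesgue_on {0..T}. indicator {..<h} t *\<^sub>R (1::real)) = h"
      using primitive_eq_integral[of T "\<lambda>_. 1::real" h] h by (simp add: primitive_def)
    have len: "measure (lebesgue_on {0..T}) {0..T} = T"
      using T by (simp add: measure_restrict_space)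
    have "(LINT t|lebesgue_on {0..T}. q t) \<le> (LINT t|lebesgue_on {0..T}. e t + \<omega> (w t) (v t))"
      using qe by (intro Bochner_Integration.integral_mono Bochner_Integration.integrable_add
          \<open>integrable _ q\<close> e_int \<omega>_int) auto
    also have "\<dots> = (LINT t|lebesgue_on {0..T}. e t) + (\<omega> a b - \<omega> b a)"
      using e_int \<omega>_int by (simp add: \<omega>_val)
    also have "(LINT t|lebesgue_on {0..T}. e t) = T * (k1 * (2 * (k * h)\<^sup>2)) + (k1 * (2 * M\<^sup>2)) * h +
        ((k2 * h * norm a) * (LINT t|lebesgue_on {0..T}. \<bar>\<alpha> t\<bar>) +
         (k2 * h * norm b) * (LINT t|lebesgue_on {0..T}. \<bar>\<beta> t\<bar>))"
      unfolding e_def using int_ind ia ib ind_val len by simp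
    also have "\<dots> \<le> (k1 * (2 * k\<^sup>2 * T\<^sup>2)) * h + (k1 * (2 * M\<^sup>2)) * h +
        ((k2 * h * norm a) * 2 + (k2 * h * norm b) * 2)"
    proof (intro add_mono mult_left_mono ab order_refl)
      have "T * (h * h) \<le> T * (T * h)"
        using h T by (intro mult_left_mono mult_right_mono) auto
      then have "k1 * (2 * k\<^sup>2) * (T * (h * h)) \<le> k1 * (2 * k\<^sup>2) * (T * (T * h))"
        by (rule mult_left_mono) (use k1 in auto)
      then show "T * (k1 * (2 * (k * h)\<^sup>2)) \<le> (k1 * (2 * k\<^sup>2 * T\<^sup>2)) * h"
        by (simp add: power2_eq_square mult_ac)
    qed (use k1 k2 h in auto)
    also have "\<dots> = c * h" unfolding c_def W_def by (simp add: algebra_simps)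
    finally have "(LINT t|lebesgue_on {0..T}. q t) \<le> \<omega> a b - \<omega> b a + c * h" by simp
    then show "\<exists>z. continuous_on {0..T} z \<and> z 0 = 0 \<and>
      has_weak_derivative T z (\<lambda>t. A *v z t + G *v (\<alpha> t *\<^sub>R a + \<beta> t *\<^sub>R b)) \<and>
      (LINT t|lebesgue_on {0..T}. (C *v z t) \<bullet> (Y *v (C *v z t)) +
         (C *v z t) \<bullet> (N *v (\<alpha> t *\<^sub>R a + \<beta> t *\<^sub>R b)))
      \<le> (C *v (G *v a)) \<bullet> (N *v b) - (C *v (G *v b)) \<bullet> (N *v a) + c * h"
      using z(1-3) unfolding q_def v_def \<omega>_def by blast
  qed
qed

section \<open>Necessary condition of second order\<close>

lemma admissible_perturbation:
  fixes J R Q :: "real ^ 'n ^ 'n" and G :: "real ^ 'm ^ 'n"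
  assumes adm: "admissible T J R Q G x0 U x u" and T: "0 \<le> T"
    and z: "continuous_on {0..T} z" "z 0 = 0"
      "has_weak_derivative T z (\<lambda>t. ((J - R) ** Q) *v z t + G *v v t)"
    and v: "L_infty T v" and U: "AE t in lebesgue_on {0..T}. u t + c *\<^sub>R v t \<in> U"
  shows "admissible T J R Q G x0 U (\<lambda>t. x t + c *\<^sub>R z t) (\<lambda>t. u t + c *\<^sub>R v t)"
proof -
  let ?A = "(J - R) ** Q"
  from adm have x: "continuous_on {0..T} x" "x 0 = x0" and u: "L_infty T u"
    and dx: "has_weak_derivative T x (\<lambda>t. ?A *v x t + G *v u t)"
    by (auto simp: admissible_def W1_infty_def)
  have rhs: "L_infty T (\<lambda>t. ?A *v y t + G *v w t)" if "continuous_on {0..T} y" "L_infty T w" for y w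
    using L_infty_add[OF L_infty_matrix_vector_mult[OF L_infty_continuous[OF that(1)]]
        L_infty_matrix_vector_mult[OF that(2)]] .
  have cont: "continuous_on {0..T} (\<lambda>t. x t + c *\<^sub>R z t)"
    by (intro continuous_intros x z)
  have Lu: "L_infty T (\<lambda>t. u t + c *\<^sub>R v t)"
    by (intro L_infty_add L_infty_scaleR L_infty_const u v)
  have "has_weak_derivative T (\<lambda>t. x t + c *\<^sub>R z t)
      (\<lambda>t. (?A *v x t + G *v u t) + c *\<^sub>R (?A *v z t + G *v v t))"
    by (intro has_weak_derivative_add_scaleR L_infty_continuous rhs x z u v dx)
  then have deriv: "has_weak_derivative T (\<lambda>t. x t + c *\<^sub>R z t)
      (\<lambda>t. ?A *v (x t + c *\<^sub>R z t) + G *v (u t + c *\<^sub>R v t))"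
    by (simp add: matrix_vector_right_distrib matrix_vector_mult_scaleR scaleR_add_right add_ac)
  show ?thesis
    unfolding admissible_def W1_infty_def
    using cont Lu deriv U rhs[OF cont Lu] L_infty_continuous[OF cont] x(2) z(2) by auto
qed

text \<open>The dynamics are linear and the cost is a quadratic polynomial of the pair \<open>(x, u)\<close>, so moving
by \<open>s\<close> and by \<open>- s\<close> along \<open>(z, v)\<close> changes the cost by \<open>s L + s\<^sup>2 B\<close> and \<open>- s L + s\<^sup>2 B\<close>
exactly. Both changes are nonnegative, and in their sum the first variation \<open>L\<close> cancels.\<close>
lemma second_variation_nonneg:
  fixes J R Q :: "real ^ 'n ^ 'n" and G :: "real ^ 'm ^ 'n"
  assumes opt: "optimal T J R Q G Y N l x0 U x u" and T: "0 \<le> T"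
    and z: "continuous_on {0..T} z" "z 0 = 0"
      "has_weak_derivative T z (\<lambda>t. ((J - R) ** Q) *v z t + G *v v t)"
    and v: "L_infty T v" and s: "0 < s"
    and U: "AE t in lebesgue_on {0..T}. u t + s *\<^sub>R v t \<in> U"
      "AE t in lebesgue_on {0..T}. u t + (- s) *\<^sub>R v t \<in> U"
  shows "0 \<le> (LINT t|lebesgue_on {0..T}.
    ((transpose G ** Q) *v z t) \<bullet> (Y *v ((transpose G ** Q) *v z t)) +
    ((transpose G ** Q) *v z t) \<bullet> (N *v v t))"
proof -
  define C where "C = transpose G ** Q"
  define \<Phi> where "\<Phi> \<xi> \<eta> = (C *v \<xi>) \<bullet> (Y *v (C *v \<xi>)) + (C *v \<xi>) \<bullet> (N *v \<eta>) + l \<bullet> \<eta>" for \<xi> \<eta>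
  define b where "b t = (C *v z t) \<bullet> (Y *v (C *v z t)) + (C *v z t) \<bullet> (N *v v t)" for t
  have cost: "cost T Q G Y N l y w = (LINT t|lebesgue_on {0..T}. \<Phi> (y t) (w t))" for y w
    by (simp add: cost_def port_output_def \<Phi>_def C_def matrix_vector_mul_assoc Let_def)
  from opt have adm: "admissible T J R Q G x0 U x u" by (simp add: optimal_def)
  have int: "integrable (lebesgue_on {0..T}) (\<lambda>t. \<Phi> (y t) (w t))"
    if "admissible T J R Q G x0 U y w" for y w
    using that unfolding \<Phi>_def admissible_def W1_infty_def
    by (intro L_infty_integrable L_infty_add L_infty_inner L_infty_matrix_vector_mult L_infty_const) auto
  have intb: "integrable (lebesgue_on {0..T}) b"
    unfolding b_def
    by (intro L_infty_integrable L_infty_add L_infty_inner L_infty_matrix_vector_mult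
        L_infty_continuous z v)
  note adm_plus = admissible_perturbation[OF adm T z v U(1)]
  note adm_minus = admissible_perturbation[OF adm T z v U(2)]
  have identity: "\<Phi> (x t + s *\<^sub>R z t) (u t + s *\<^sub>R v t) + \<Phi> (x t + (- s) *\<^sub>R z t) (u t + (- s) *\<^sub>R v t) =
      2 * \<Phi> (x t) (u t) + 2 * s\<^sup>2 * b t" for t
    unfolding \<Phi>_def b_def matrix_vector_right_distrib matrix_vector_mult_scaleR
      inner_add_left inner_add_right inner_scaleR_left inner_scaleR_right
    by (simp add: algebra_simps power2_eq_square)
  have "cost T Q G Y N l (\<lambda>t. x t + s *\<^sub>R z t) (\<lambda>t. u t + s *\<^sub>R v t) +
      cost T Q G Y N l (\<lambda>t. x t + (- s) *\<^sub>R z t) (\<lambda>t. u t + (- s) *\<^sub>R v t) =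
      (LINT t|lebesgue_on {0..T}. 2 * \<Phi> (x t) (u t) + 2 * s\<^sup>2 * b t)"
    unfolding cost identity[symmetric]
    by (intro Bochner_Integration.integral_add[symmetric] int adm_plus adm_minus)
  also have "\<dots> = 2 * cost T Q G Y N l x u + 2 * s\<^sup>2 * (LINT t|lebesgue_on {0..T}. b t)"
    using int[OF adm] intb by (simp add: cost)
  finally have "0 \<le> 2 * s\<^sup>2 * (LINT t|lebesgue_on {0..T}. b t)"
    using opt adm_plus adm_minus unfolding optimal_def by (smt (verit))
  then show ?thesis
    using s by (simp add: zero_le_mult_iff b_def C_def)
qed

text \<open>Openness only gives, for almost every \<open>t\<close>, some ball around \<open>u t\<close> inside \<open>U\<close>, with a radius
that varies measurably with \<open>t\<close> and need not be bounded below on any interval. The sets \<open>E k\<close>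
on which the radius \<open>1 / (k + 1)\<close> works increase to a set of full measure, so each of finitely
many intervals meets one of them, and then a common one, in positive measure. The set is in
general very irregular, which is why the controls built on it are merely measurable.\<close>
lemma uniformly_interior_set_exists:
  fixes u :: "real \<Rightarrow> 'a::euclidean_space"
  assumes "open U" and u: "u \<in> borel_measurable (lebesgue_on {0..T})"
    and ae: "AE t in lebesgue_on {0..T}. u t \<in> U"
    and I: "finite I" "\<And>c d. (c, d) \<in> I \<Longrightarrow> 0 \<le> c \<and> c < d \<and> d \<le> T"
  obtains \<delta> E where "0 < \<delta>" "E \<in> sets lebesgue" "\<And>t. t \<in> E \<Longrightarrow> ball (u t) \<delta> \<subseteq> U"
    "\<And>c d. (c, d) \<in> I \<Longrightarrow> 0 < measure lebesgue (E \<inter> {c..<d})"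
proof -
  define S where "S k = {y. ball y (1 / Suc k) \<subseteq> U}" for k :: nat
  define E where "E k = {t \<in> {0..T}. u t \<in> S k}" for k
  have "- S k = (\<Union>c\<in>-U. ball c (1 / Suc k))" for k
    by (auto simp: S_def dist_commute subset_eq)
  then have "closed (S k)" for k
    unfolding closed_def by auto
  then have "u -` S k \<inter> space (lebesgue_on {0..T}) \<in> sets (lebesgue_on {0..T})" for k
    by (intro measurable_sets[OF u]) auto
  then have E_sets: "E k \<in> sets lebesgue" for k
    by (simp add: sets_restrict_space_iff E_def vimage_def Int_def conj_commute)
  have lm: "E k \<inter> {c..<d} \<in> lmeasurable" for k c d
    by (rule bounded_set_imp_lmeasurable)
      (auto intro: bounded_subset[of "{c..d}"] sets.Int E_sets)
  have mono: "E j \<subseteq> E k" if "j \<le> k" for j k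
  proof -
    have "ball y (1 / real (Suc k)) \<subseteq> ball y (1 / real (Suc j))" for y :: 'a
      using that by (intro subset_ball divide_left_mono) auto
    then show ?thesis unfolding E_def S_def by blast
  qed
  have ex: "\<exists>k. 0 < measure lebesgue (E k \<inter> {c..<d})" if "(c, d) \<in> I" for c d
  proof (rule ccontr)
    assume "\<nexists>k. 0 < measure lebesgue (E k \<inter> {c..<d})"
    then have "measure lebesgue (E k \<inter> {c..<d}) = 0" for k
      using measure_nonneg[of lebesgue "E k \<inter> {c..<d}"] by (metis less_eq_real_def)
    then have "negligible (E k \<inter> {c..<d})" for k
      using negligible_iff_measure0[OF lm] by blast
    then have "negligible (\<Union>k. E k \<inter> {c..<d})"
      by (intro negligible_countable_Union) auto
    moreover have "AE t in lebesgue. t \<in> {0..T} \<longrightarrow> u t \<in> U"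
      using ae by (subst (asm) AE_restrict_space_iff) auto
    then obtain Z where Z: "negligible Z" "{t \<in> {0..T}. u t \<notin> U} \<subseteq> Z"
      unfolding eventually_ae_filter by (auto simp: negligible_iff_null_sets subset_eq)
    moreover have "box c d \<subseteq> (\<Union>k. E k \<inter> {c..<d}) \<union> Z"
    proof
      fix t assume t: "t \<in> box c d"
      then have t': "t \<in> {0..T}" "t \<in> {c..<d}" using I(2)[OF that] by auto
      show "t \<in> (\<Union>k. E k \<inter> {c..<d}) \<union> Z"
      proof (cases "u t \<in> U")
        case True
        then obtain e where "e > 0" "ball (u t) e \<subseteq> U"
          using \<open>open U\<close> by (auto simp: open_contains_ball)
        moreover obtain k where "1 / real (Suc k) < e"
          using nat_approx_posE[OF \<open>e > 0\<close>] by blast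
        ultimately have "t \<in> E k"
          using t' subset_ball[of "1 / real (Suc k)" e "u t"] by (auto simp: E_def S_def)
        then show ?thesis using t' by blast
      qed (use Z t' in auto)
    qed
    ultimately have "negligible (box c d)"
      using negligible_subset negligible_Un by blast
    then have "box c d = {}" by (simp only: negligible_interval)
    then show False using I(2)[OF that] by auto
  qed
  then have "\<forall>p\<in>I. \<exists>k. 0 < measure lebesgue (E k \<inter> {fst p..<snd p})"
    by auto
  from bchoice[OF this] obtain k
    where k: "\<And>p. p \<in> I \<Longrightarrow> 0 < measure lebesgue (E (k p) \<inter> {fst p..<snd p})"
    by blast
  define K where "K = Max (k ` I)"
  show thesis
  proof (rule that[of "1 / Suc K" "E K"])
    show "ball (u t) (1 / real (Suc K)) \<subseteq> U" if "t \<in> E K" for t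
      using that by (simp add: E_def S_def)
    fix c d assume cd: "(c, d) \<in> I"
    then have "E (k (c, d)) \<subseteq> E K"
      using I(1) by (intro mono) (auto simp: K_def)
    then have "measure lebesgue (E (k (c, d)) \<inter> {c..<d}) \<le> measure lebesgue (E K \<inter> {c..<d})"
      by (intro measure_mono_fmeasurable lm fmeasurableD[OF lm]) auto
    then show "0 < measure lebesgue (E K \<inter> {c..<d})"
      using k[OF cd] by simp
  qed (auto simp: E_sets)
qed

text \<open>If the inequality failed by \<open>\<kappa> > 0\<close>, a loop with \<open>c * h < \<kappa>\<close>, supported where \<open>u\<close> stays
uniformly inside \<open>U\<close>, would make the second variation negative.\<close>
lemma optimal_loop_form_le:
  fixes J R Q :: "real ^ 'n ^ 'n" and G :: "real ^ 'm ^ 'n" and a b :: "real ^ 'm"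
  assumes T: "0 < T" and "open U" and opt: "optimal T J R Q G Y N l x0 U x u"
  defines "C \<equiv> transpose G ** Q"
  shows "(C *v (G *v b)) \<bullet> (N *v a) \<le> (C *v (G *v a)) \<bullet> (N *v b)"
proof (rule ccontr)
  define \<kappa> where "\<kappa> = (C *v (G *v b)) \<bullet> (N *v a) - (C *v (G *v a)) \<bullet> (N *v b)"
  assume "\<not> ?thesis"
  then have \<kappa>: "0 < \<kappa>" by (simp add: \<kappa>_def)
  from opt have u: "L_infty T u" "AE t in lebesgue_on {0..T}. u t \<in> U"
    by (auto simp: optimal_def admissible_def)
  obtain c where c: "\<And>h E \<alpha> \<beta>. 0 < h \<Longrightarrow> h \<le> T \<Longrightarrow> loop_controls T h E \<alpha> \<beta> \<Longrightarrow>
    \<exists>z. continuous_on {0..T} z \<and> z 0 = 0 \<and>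
      has_weak_derivative T z (\<lambda>t. ((J - R) ** Q) *v z t + G *v (\<alpha> t *\<^sub>R a + \<beta> t *\<^sub>R b)) \<and>
      (LINT t|lebesgue_on {0..T}. (C *v z t) \<bullet> (Y *v (C *v z t)) +
         (C *v z t) \<bullet> (N *v (\<alpha> t *\<^sub>R a + \<beta> t *\<^sub>R b)))
      \<le> (C *v (G *v a)) \<bullet> (N *v b) - (C *v (G *v b)) \<bullet> (N *v a) + c * h"
    using loop_response_cost[OF T] by blast
  \<comment> \<open>The \<open>+ 1\<close> keeps the denominator positive.\<close>
  define h where "h = min T (\<kappa> / (2 * (\<bar>c\<bar> + 1)))"
  have h: "0 < h" "h \<le> T" using T \<kappa> by (auto simp: h_def)
  have "c * h \<le> (\<bar>c\<bar> + 1) * (\<kappa> / (2 * (\<bar>c\<bar> + 1)))"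
    using h by (intro mult_mono) (auto simp: h_def)
  also have "\<dots> = \<kappa> / 2"
  proof -
    have "d * (\<kappa> / (2 * d)) = \<kappa> / 2" if "0 < d" for d :: real
      using that by simp
    then show ?thesis using abs_ge_zero[of c] by (meson add_nonneg_pos zero_less_one)
  qed
  also have "\<dots> < \<kappa>" using \<kappa> by simp
  finally have ch: "c * h < \<kappa>" .
  define I where "I = (\<lambda>i. (real i * h / 4, real (Suc i) * h / 4)) ` {..<4}"
  have "0 \<le> c \<and> c < d \<and> d \<le> T" if "(c, d) \<in> I" for c d
  proof -
    from that obtain i :: nat where i: "i < 4" "c = real i * h / 4" "d = real (Suc i) * h / 4"
      by (auto simp: I_def)
    have "real (Suc i) * h \<le> 4 * h" using i(1) h by (intro mult_right_mono) auto
    then have "d \<le> T" using i(3) h by linarith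
    moreover have "c < d"
      unfolding i(2,3) using h by (intro divide_strict_right_mono mult_strict_right_mono) auto
    moreover have "0 \<le> c" unfolding i(2) using h by simp
    ultimately show ?thesis by blast
  qed
  moreover have "finite I" by (simp add: I_def)
  ultimately obtain \<delta> E where E: "0 < \<delta>" "E \<in> sets lebesgue"
    "\<And>t. t \<in> E \<Longrightarrow> ball (u t) \<delta> \<subseteq> U"
    and E_pos: "\<And>c d. (c, d) \<in> I \<Longrightarrow> 0 < measure lebesgue (E \<inter> {c..<d})"
    using uniformly_interior_set_exists[OF \<open>open U\<close> L_infty_measurable[OF u(1)] u(2)] by metis
  have pos: "0 < measure lebesgue (E \<inter> {real i * h / 4..<real (Suc i) * h / 4})" if "i < 4" for i
    by (rule E_pos) (unfold I_def, rule image_eqI[of _ _ i], use that in auto)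
  obtain \<alpha> \<beta> where loop: "loop_controls T h E \<alpha> \<beta>"
    using loop_controls_exist[OF E(2) h pos] by blast
  define v where "v t = \<alpha> t *\<^sub>R a + \<beta> t *\<^sub>R b" for t
  obtain z where z: "continuous_on {0..T} z" "z 0 = 0"
      "has_weak_derivative T z (\<lambda>t. ((J - R) ** Q) *v z t + G *v v t)"
      "(LINT t|lebesgue_on {0..T}. (C *v z t) \<bullet> (Y *v (C *v z t)) + (C *v z t) \<bullet> (N *v v t))
        \<le> - \<kappa> + c * h"
    using c[OF h loop] unfolding v_def \<kappa>_def by auto
  have v: "L_infty T v"
    using loop unfolding loop_controls_def v_def
    by (intro L_infty_add L_infty_scaleR L_infty_const) auto
  then obtain B where B: "AE t in lebesgue_on {0..T}. norm (v t) \<le> B"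
    by (auto simp: L_infty_def)
  define s where "s = \<delta> / (\<bar>B\<bar> + 1)"
  have s: "0 < s" using E(1) by (simp add: s_def)
  have inside: "AE t in lebesgue_on {0..T}. u t + r *\<^sub>R v t \<in> U" if "\<bar>r\<bar> = s" for r
    using B u(2)
  proof eventually_elim
    case (elim t)
    show ?case
    proof (cases "t \<in> E")
      case True
      have "norm (r *\<^sub>R v t) \<le> s * \<bar>B\<bar>"
        using elim(1) s that by (auto intro!: mult_left_mono)
      also have "\<dots> < \<delta>" using E(1) by (simp add: s_def field_simps)
      finally have "u t + r *\<^sub>R v t \<in> ball (u t) \<delta>" by (simp add: dist_norm)
      then show ?thesis using E(3)[OF True] by blast
    next
      case False
      then have "v t = 0" using loop by (simp add: loop_controls_def v_def)
      then show ?thesis using elim(2) by simp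
    qed
  qed
  have "0 \<le> (LINT t|lebesgue_on {0..T}. (C *v z t) \<bullet> (Y *v (C *v z t)) + (C *v z t) \<bullet> (N *v v t))"
    unfolding C_def
    using s T by (intro second_variation_nonneg[OF opt _ z(1-3) v s] inside) auto
  then show False using z(4) ch by simp
qed

lemma transpose_eq_self_iff:
  fixes M :: "real ^ 'm ^ 'm"
  assumes "\<And>p q. p \<bullet> (M *v q) = q \<bullet> (M *v p)"
  shows "transpose M = M"
proof -
  have "p \<bullet> (transpose M *v q) = p \<bullet> (M *v q)" for p q
  proof -
    have "p \<bullet> (transpose M *v q) = (q v* M) \<bullet> p"
      by (simp add: inner_commute)
    also have "\<dots> = q \<bullet> (M *v p)" by (rule dot_lmul_matrix)
    finally show ?thesis using assms by simp
  qed
  then have "transpose M *v q = M *v q" for q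
    using vector_eq_ldot by blast
  then show ?thesis by (simp add: matrix_eq)
qed

text \<open>The matrix \<open>N\<^sup>T G\<^sup>T Q G\<close> represents the bilinear form \<open>(C G q) \<bullet> (N p)\<close> with
\<open>C = G\<^sup>T Q\<close>, and the inequality for the two orientations of the loop makes this form symmetric.\<close>

theorem theorem4p1:
  fixes J R Q :: "real ^ 'n ^ 'n" and G :: "real ^ 'm ^ 'n"
    and Y N :: "real ^ 'm ^ 'm" and l :: "real ^ 'm"
    and x0 :: "real ^ 'n" and U :: "(real ^ 'm) set" and T :: real
    and x :: "real \<Rightarrow> real ^ 'n" and u :: "real \<Rightarrow> real ^ 'm"
  assumes "T > 0"
    and "transpose J = - J"
    and "pos_semidef R"
    and "pos_def Q"
    and "CARD('m) \<le> CARD('n)" and "rank G = CARD('m)"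
    and "pos_semidef Y"
    and "open U"
    and "optimal T J R Q G Y N l x0 U x u"
  shows "transpose (transpose N ** transpose G ** Q ** G) =
    transpose N ** transpose G ** Q ** G"
proof (rule transpose_eq_self_iff)
  define C where "C = transpose G ** Q"
  have form: "p \<bullet> ((transpose N ** transpose G ** Q ** G) *v q) = (C *v (G *v q)) \<bullet> (N *v p)" for p q
  proof -
    have "p \<bullet> ((transpose N ** transpose G ** Q ** G) *v q) = p \<bullet> (transpose N *v (C *v (G *v q)))"
      by (simp only: C_def matrix_vector_mul_assoc matrix_mul_assoc)
    also have "\<dots> = ((C *v (G *v q)) v* N) \<bullet> p"
      by (simp only: transpose_matrix_vector inner_commute)
    also have "\<dots> = (C *v (G *v q)) \<bullet> (N *v p)" by (rule dot_lmul_matrix)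
    finally show ?thesis .
  qed
  fix p q :: "real ^ 'm"
  show "p \<bullet> ((transpose N ** transpose G ** Q ** G) *v q) =
      q \<bullet> ((transpose N ** transpose G ** Q ** G) *v p)"
    unfolding form C_def
    using optimal_loop_form_le[OF \<open>T > 0\<close> \<open>open U\<close> \<open>optimal T J R Q G Y N l x0 U x u\<close>]
    by (intro antisym)
qed

end
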